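(* Every nonnegative separable polynomial $p:\mathbb{R}^n\to\mathbb{R}$ can be written as the sum of nonnegative univariate polynomials (each in one of the variables $x_1,\dots,x_n$). In particular, a separable polynomial is nonnegative if and only if it is a sum of squares.
   Context: All polynomials have real coefficients. A polynomial $p:\mathbb{R}^n\to\mathbb{R}$ is separable if $p(x)=\sum_{i=1}^n p_i(x_i)$ for some univariate polynomials $p_i:\mathbb{R}\to\mathbb{R}$. It is nonnegative if $p(x)\ge 0$ for all $x\in\mathbb{R}^n$. It is a sum of squares (sos) if $p=\sum_{i=1}^m q_i^2$ for some polynomials $q_1,\dots,q_m$. *)

theory Defs
  imports "HOL-Analysis.Analysis" "HOL-Computational_Algebra.Polynomial"
begin

(* Polynomials in n real variables are taken as functions on real ^ 'n, with n = CARD('n),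
   using real_polynomial_function: the least class of functions that contains the constants
   and the (bounded) linear functionals and is closed under sums and products.  On real ^ 'n
   these are exactly the functions given by polynomials in the n coordinates. *)

definition separable_polynomial :: "(real ^ 'n \<Rightarrow> real) \<Rightarrow> bool" where
  "separable_polynomial p \<longleftrightarrow>
     real_polynomial_function p \<and>
     (\<exists>ps :: 'n \<Rightarrow> real poly. \<forall>x. p x = (\<Sum>i\<in>UNIV. poly (ps i) (x $ i)))"

definition nonneg_polynomial :: "(real ^ 'n \<Rightarrow> real) \<Rightarrow> bool" where
  "nonneg_polynomial p \<longleftrightarrow> real_polynomial_function p \<and> (\<forall>x. p x \<ge> 0)"

definition sos_polynomial :: "(real ^ 'n \<Rightarrow> real) \<Rightarrow> bool" where
  "sos_polynomial p \<longleftrightarrow>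
     real_polynomial_function p \<and>
     (\<exists>(m :: nat) (q :: nat \<Rightarrow> real ^ 'n \<Rightarrow> real).
        (\<forall>i\<in>{1..m}. real_polynomial_function (q i)) \<and>
        (\<forall>x. p x = (\<Sum>i=1..m. (q i x)\<^sup>2)))"

end

theory Submission
  imports Defs
begin

text \<open>
  Each summand of a nonnegative separable polynomial is bounded below, as one sees by fixing
  the other variables, hence attains a minimum.  Evaluating at the point whose coordinates are the
  minimisers shows that the minima have a nonnegative sum, so subtracting from each summand
  its minimum and redistributing their sum equally makes every summand nonnegative.

  A nonnegative univariate polynomial is a sum of squares by induction on the degree: if it attains
  its minimum \<open>m\<close> at \<open>a\<close>, then it equals \<open>m + (X - a)\<^sup>2 s\<close> with \<open>s\<close> nonnegative of smaller degree,
  and \<open>m\<close> is the square of a constant.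
\<close>

text \<open>A nonconstant polynomial is unbounded in absolute value at infinity, and the lower bound
  rules out large negative values. So the minimum over a large compact interval is global.\<close>

lemma poly_bounded_below_attains_inf:
  fixes p :: "real poly"
  assumes "\<And>t. b \<le> poly p t"
  obtains a where "\<And>t. poly p a \<le> poly p t"
proof (cases "degree p = 0")
  case True
  then obtain c where "p = [:c:]"
    by (rule degree_eq_zeroE)
  then show ?thesis
    using that by simp
next
  case False
  \<comment> \<open>If \<open>C \<le> \<bar>poly p t\<bar>\<close>, then \<open>poly p t\<close>
    cannot be negative without falling below \<open>b\<close>, hence it exceeds
    \<open>poly p 0\<close>. The \<open>+ 1\<close> makes \<open>C\<close> positive.\<close>
  define C where "C = \<bar>poly p 0\<bar> + \<bar>b\<bar> + 1"
  have "filterlim (poly p) at_infinity at_infinity"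
    using False by (intro filterlim_poly_at_infinity) simp
  then have "\<forall>\<^sub>F t in at_infinity. C \<le> norm (poly p t)"
    unfolding filterlim_at_infinity[OF order_refl] by (simp add: C_def)
  then obtain R where R: "\<And>t. R \<le> \<bar>t\<bar> \<Longrightarrow> C \<le> \<bar>poly p t\<bar>"
    unfolding eventually_at_infinity by auto
  \<comment> \<open>\<open>R\<close> may be negative; with \<open>\<bar>R\<bar>\<close> the interval
    is nonempty and contains 0.\<close>
  obtain a where a: "\<And>t. t \<in> {-\<bar>R\<bar>..\<bar>R\<bar>} \<Longrightarrow> poly p a \<le> poly p t"
    using continuous_attains_inf[of "{-\<bar>R\<bar>..\<bar>R\<bar>}" "poly p"]
    by (fastforce intro: continuous_intros)
  have "poly p a \<le> poly p t" for t
  proof (cases "\<bar>t\<bar> \<le> \<bar>R\<bar>")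
    case True
    then show ?thesis by (intro a) auto
  next
    case False
    then have "C \<le> \<bar>poly p t\<bar>" by (intro R) linarith
    then have "poly p 0 \<le> poly p t"
      using assms[of t] unfolding C_def by linarith
    moreover have "poly p a \<le> poly p 0" by (rule a) simp
    ultimately show ?thesis by simp
  qed
  then show ?thesis by (rule that)
qed

text \<open>At a minimiser both \<open>p - [:poly p a:]\<close> and its derivative vanish, so
  \<open>a\<close> is a double root. The cofactor inherits its sign from
  \<open>p - [:poly p a:]\<close>.\<close>

lemma poly_min_eq_square_mult:
  fixes p :: "real poly"
  assumes min: "\<And>t. poly p a \<le> poly p t"
  obtains s where "p = [:poly p a:] + [:-a, 1:]\<^sup>2 * s" "\<And>t. 0 \<le> poly s t"
proof -
  have "poly (p - [:poly p a:]) a = 0" by simp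
  then obtain r where r: "p - [:poly p a:] = [:-a, 1:] * r"
    unfolding poly_eq_0_iff_dvd by (rule dvdE)
  have "poly (pderiv p) a = 0"
    using min by (intro DERIV_local_min[OF poly_DERIV zero_less_one]) auto
  moreover have "pderiv p = pderiv ([:poly p a:] + [:-a, 1:] * r)"
    using r by (metis add.commute diff_add_cancel)
  moreover have "poly (pderiv ([:poly p a:] + [:-a, 1:] * r)) a = poly r a"
    unfolding pderiv_add pderiv_mult by (simp add: pderiv_pCons)
  ultimately have "poly r a = 0"
    by simp
  then obtain s where s: "r = [:-a, 1:] * s"
    unfolding poly_eq_0_iff_dvd by (rule dvdE)
  have p: "p = [:poly p a:] + [:-a, 1:]\<^sup>2 * s"
    using r unfolding s power2_eq_square by (metis add.commute diff_add_cancel mult.assoc)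
  have off: "0 \<le> poly s t" if "t \<noteq> a" for t
  proof -
    have "poly p t = poly p a + (t - a)\<^sup>2 * poly s t"
      by (subst p) (simp add: power2_eq_square algebra_simps)
    then have "0 \<le> (t - a)\<^sup>2 * poly s t"
      using min[of t] by simp
    then show ?thesis
      using that by (simp add: zero_le_mult_iff)
  qed
  \<comment> \<open>Dividing by the square says nothing at \<open>a\<close> itself; there the sign
    follows by continuity.\<close>
  have "(poly s \<longlongrightarrow> poly s a) (at a)"
    by (rule isContD) simp
  then have "0 \<le> poly s a"
    by (rule tendsto_lowerbound) (auto simp: eventually_at_filter off)
  with off have "0 \<le> poly s t" for t by (cases "t = a") auto
  with p show ?thesis by (rule that)
qed

lemma nonneg_poly_sum_of_squares:
  fixes p :: "real poly"
  assumes "\<And>t. 0 \<le> poly p t"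
  shows "\<exists>(m :: nat) q. p = (\<Sum>j<m. (q j)\<^sup>2)"
  using assms
proof (induction "degree p" arbitrary: p rule: less_induct)
  case less
  obtain a where a: "\<And>t. poly p a \<le> poly p t"
    using poly_bounded_below_attains_inf[OF less.prems] by blast
  obtain s where s: "p = [:poly p a:] + [:-a, 1:]\<^sup>2 * s" "\<And>t. 0 \<le> poly s t"
    using poly_min_eq_square_mult[OF a] by blast
  have const: "[:poly p a:] = [:sqrt (poly p a):]\<^sup>2"
    using less.prems[of a] by (simp add: power2_eq_square)
  show ?case
  proof (cases "s = 0")
    \<comment> \<open>Here \<open>p\<close> is constant, so the degree does not drop and one square
      is given directly.\<close>
    case True
    then have "p = (\<Sum>j<Suc 0. [:sqrt (poly p a):]\<^sup>2)"
      using s(1) const by simp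
    then show ?thesis by (intro exI[of _ "Suc 0"] exI[of _ "\<lambda>_. [:sqrt (poly p a):]"])
  next
    case False
    then have "degree ([:-a, 1:]\<^sup>2 * s) = 2 + degree s"
      by (subst degree_mult_eq) (auto simp: degree_power_eq)
    moreover have "degree p = degree ([:-a, 1:]\<^sup>2 * s)"
      using calculation by (subst s(1), intro degree_add_eq_right) simp
    ultimately have "degree s < degree p" by simp
    with less.hyps s(2) obtain m :: nat and q where q: "s = (\<Sum>j<m. (q j)\<^sup>2)" by blast
    \<comment> \<open>The constant square comes first; the squares for \<open>s\<close> absorb the
      factor \<open>[:-a, 1:]\<close>.\<close>
    define q' where "q' = case_nat [:sqrt (poly p a):] (\<lambda>j. [:-a, 1:] * q j)"
    have "p = [:sqrt (poly p a):]\<^sup>2 + (\<Sum>j<m. ([:-a, 1:] * q j)\<^sup>2)"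
      using s(1) unfolding const[symmetric] q by (simp only: power_mult_distrib sum_distrib_left)
    also have "\<dots> = (\<Sum>j<Suc m. (q' j)\<^sup>2)"
      unfolding sum.lessThan_Suc_shift q'_def by simp
    finally show ?thesis by blast
  qed
qed

lemma real_polynomial_function_poly_nth:
  fixes i :: "'n::finite"
  shows "real_polynomial_function (\<lambda>x :: real ^ 'n. poly q (x $ i))"
proof (induction q)
  case 0
  show ?case by (simp add: real_polynomial_function.intros(2))
next
  case (pCons a q)
  have "real_polynomial_function (\<lambda>x :: real ^ 'n. x $ i)"
    by (intro real_polynomial_function.intros(1) bounded_linear_vec_nth)
  with pCons show ?case
    by (simp add: real_polynomial_function.intros)
qed

text \<open>Frees sums of squares from the index range \<open>{1..m}\<close> of the definition, by a
  bijection with the given finite set.\<close>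

lemma sos_polynomial_sum_squares:
  fixes f :: "'a \<Rightarrow> real ^ 'n \<Rightarrow> real"
  assumes "finite A" and f: "\<And>k. k \<in> A \<Longrightarrow> real_polynomial_function (f k)"
  shows "sos_polynomial (\<lambda>x. \<Sum>k\<in>A. (f k x)\<^sup>2)"
proof -
  obtain h where h: "bij_betw h {1..card A} A"
    using ex_bij_betw_nat_finite_1[OF \<open>finite A\<close>] by blast
  have "real_polynomial_function (\<lambda>x. \<Sum>k\<in>A. (f k x)\<^sup>2)"
    unfolding power2_eq_square
    by (intro real_polynomial_function_sum[where f = "\<lambda>x k. f k x * f k x"]
        real_polynomial_function.intros(4) assms)
  moreover have "real_polynomial_function (f (h i))" if "i \<in> {1..card A}" for i
    using bij_betwE[OF h] that f by blast
  moreover have "(\<Sum>k\<in>A. (f k x)\<^sup>2) = (\<Sum>i=1..card A. (f (h i) x)\<^sup>2)" for x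
    by (rule sum.reindex_bij_betw[OF h, symmetric])
  ultimately show ?thesis
    unfolding sos_polynomial_def by (intro conjI exI[of _ "card A"] exI[of _ "\<lambda>i. f (h i)"]) auto
qed

lemma separable_nonneg_imp_sum_nonneg:
  fixes ps :: "'n::finite \<Rightarrow> real poly"
  assumes nonneg: "\<And>x :: real ^ 'n. 0 \<le> (\<Sum>i\<in>UNIV. poly (ps i) (x $ i))"
  obtains qs :: "'n \<Rightarrow> real poly"
  where "\<And>i t. 0 \<le> poly (qs i) t"
    and "\<And>x :: real ^ 'n. (\<Sum>i\<in>UNIV. poly (ps i) (x $ i)) = (\<Sum>i\<in>UNIV. poly (qs i) (x $ i))"
proof -
  have "\<exists>a. \<forall>t. poly (ps i) a \<le> poly (ps i) t" for i
  proof -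
    \<comment> \<open>Nonnegativity at the point with \<open>t\<close> in coordinate
      \<open>i\<close> and 0 elsewhere.\<close>
    have "- (\<Sum>j\<in>UNIV - {i}. poly (ps j) 0) \<le> poly (ps i) t" for t
      using nonneg[of "\<chi> j. if j = i then t else 0"]
      by (simp add: sum.remove[of UNIV i])
    then show ?thesis
      using poly_bounded_below_attains_inf[of _ "ps i"] by blast
  qed
  then obtain a where a: "\<And>i t. poly (ps i) (a i) \<le> poly (ps i) t" by metis
  define m where "m i = poly (ps i) (a i)" for i
  \<comment> \<open>\<open>c\<close> is the average of the minima. Each \<open>qs i\<close> has
    minimum \<open>c\<close>, and the shifts \<open>c - m i\<close> sum to 0.\<close>
  define c where "c = sum m UNIV / real CARD('n)"
  define qs where "qs i = ps i + [:c - m i:]" for i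
  have "0 \<le> sum m UNIV"
    using nonneg[of "\<chi> i. a i"] by (simp add: m_def)
  then have "0 \<le> c"
    by (simp add: c_def)
  then have "0 \<le> poly (qs i) t" for i t
    using a[of i t] by (simp add: qs_def m_def)
  moreover have "(\<Sum>i\<in>UNIV. poly (ps i) (x $ i)) = (\<Sum>i\<in>UNIV. poly (qs i) (x $ i))" for x :: "real ^ 'n"
    by (simp add: qs_def sum.distrib sum_subtractf c_def)
  ultimately show ?thesis by (rule that)
qed

lemma sos_polynomial_sum_nonneg_poly:
  fixes qs :: "'n::finite \<Rightarrow> real poly"
  assumes "\<And>i t. 0 \<le> poly (qs i) t"
  shows "sos_polynomial (\<lambda>x. \<Sum>i\<in>UNIV. poly (qs i) (x $ i))"
proof -
  have "\<forall>i. \<exists>(m :: nat) q. qs i = (\<Sum>j<m. (q j)\<^sup>2)"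
    using nonneg_poly_sum_of_squares assms by blast
  then obtain m :: "'n \<Rightarrow> nat" and r where r: "\<And>i. qs i = (\<Sum>j<m i. (r i j)\<^sup>2)"
    by metis
  \<comment> \<open>The number of squares depends on \<open>i\<close>, so the double sum is
    flattened over dependent pairs.\<close>
  have "(\<Sum>i\<in>UNIV. poly (qs i) (x $ i)) =
      (\<Sum>k\<in>(SIGMA i:UNIV. {..<m i}). (poly (r (fst k) (snd k)) (x $ fst k))\<^sup>2)" for x :: "real ^ 'n"
    by (simp add: r poly_sum sum.Sigma case_prod_beta)
  then show ?thesis
    by (simp add: sos_polynomial_sum_squares real_polynomial_function_poly_nth)
qed

theorem lemma2p1:
  fixes p :: "real ^ 'n \<Rightarrow> real"
  assumes "separable_polynomial p"
  shows "(nonneg_polynomial p \<longrightarrow>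
            (\<exists>qs :: 'n \<Rightarrow> real poly.
               (\<forall>i t. poly (qs i) t \<ge> 0) \<and>
               (\<forall>x. p x = (\<Sum>i\<in>UNIV. poly (qs i) (x $ i)))))
       \<and> (nonneg_polynomial p \<longleftrightarrow> sos_polynomial p)"
proof -
  obtain ps :: "'n \<Rightarrow> real poly" where ps: "\<And>x. p x = (\<Sum>i\<in>UNIV. poly (ps i) (x $ i))"
    using assms unfolding separable_polynomial_def by blast
  have decomp: "\<exists>qs :: 'n \<Rightarrow> real poly. (\<forall>i t. poly (qs i) t \<ge> 0) \<and>
      (\<forall>x. p x = (\<Sum>i\<in>UNIV. poly (qs i) (x $ i)))" if "nonneg_polynomial p"
  proof -
    have "0 \<le> (\<Sum>i\<in>UNIV. poly (ps i) (x $ i))" for x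
      using that ps unfolding nonneg_polynomial_def by metis
    from separable_nonneg_imp_sum_nonneg[OF this] ps show ?thesis by metis
  qed
  have "sos_polynomial p" if nonneg: "nonneg_polynomial p"
  proof -
    obtain qs :: "'n \<Rightarrow> real poly" where qs: "\<And>i t. poly (qs i) t \<ge> 0"
      and p: "\<And>x. p x = (\<Sum>i\<in>UNIV. poly (qs i) (x $ i))"
      using decomp[OF nonneg] by blast
    have "p = (\<lambda>x. \<Sum>i\<in>UNIV. poly (qs i) (x $ i))"
      using p by (rule ext)
    with qs show ?thesis
      using sos_polynomial_sum_nonneg_poly by metis
  qed
  moreover have "nonneg_polynomial p" if "sos_polynomial p"
    using that unfolding sos_polynomial_def nonneg_polynomial_def
    by (metis sum_nonneg zero_le_power2)
  ultimately show ?thesis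
    using decomp by blast
qed

end
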